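(* Let $m\ge 1$ be an integer, let $\omega=2\pi m$, and let $N\ge 0$ be an integer. Define real-valued functions $p_0,\dots,p_N$ and $q_0,\dots,q_N$ on $[-1,1]$ recursively (taking only those with index at most $N$) by $$p_0(x)=\cos(\omega x),\qquad q_0(x)=\sin(\omega x),$$ $$p_1(x)=x\,p_0(x)+\frac{1}{2\omega}q_0(x),\qquad q_1(x)=x\,q_0(x)+\frac{1}{2\omega}p_0(x),$$ and, for $1\le k\le N-1$, $$p_{k+1}(x)=x\,p_k(x)-\frac{\langle xp_k,q_k\rangle}{\langle q_k,q_k\rangle}q_k(x)-\frac{\langle xp_k,p_{k-1}\rangle}{\langle p_{k-1},p_{k-1}\rangle}p_{k-1}(x),$$ $$q_{k+1}(x)=x\,q_k(x)-\frac{\langle xq_k,p_k\rangle}{\langle p_k,p_k\rangle}p_k(x)-\frac{\langle xq_k,q_{k-1}\rangle}{\langle q_{k-1},q_{k-1}\rangle}q_{k-1}(x).$$ Then the functions $p_0,q_0,p_1,q_1,\dots,p_N,q_N$ form a basis of the real linear span of $\{x^k\sin(\omega x),\,x^k\cos(\omega x)\}_{k=0}^N$.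
   Context: For real-valued continuous functions $f,g$ on $[-1,1]$, the inner product is $\langle f,g\rangle=\int_{-1}^1 f(x)g(x)\,dx$. The notation $xp_k$ denotes the function $x\mapsto x\,p_k(x)$, and similarly for $xq_k$. *)

theory Defs
  imports "HOL-Analysis.Analysis" "HOL-Library.Function_Algebras"
begin

text \<open>Pointwise scalar multiplication, so that \<open>span\<close> and \<open>independent\<close> are available for
  real-valued functions; addition is the pointwise one of \<open>Function_Algebras\<close>.\<close>

instantiation "fun" :: (type, real_vector) real_vector
begin

definition scaleR_fun :: "real \<Rightarrow> ('a \<Rightarrow> 'b) \<Rightarrow> 'a \<Rightarrow> 'b" where
  "scaleR_fun c f = (\<lambda>x. c *\<^sub>R f x)"

instance
  by standard (simp_all add: scaleR_fun_def fun_eq_iff scaleR_add_right scaleR_add_left)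

end

definition ip :: "(real \<Rightarrow> real) \<Rightarrow> (real \<Rightarrow> real) \<Rightarrow> real" where
  "ip f g = integral {-1..1} (\<lambda>x. f x * g x)"

text \<open>The recursion for \<open>p\<close> and \<open>q\<close> does not depend on \<open>N\<close>, so both sequences are defined for all
  indices. They are given by formulas on all of \<open>\<real>\<close>, but only their values on \<open>[-1,1]\<close>
  enter the recursion (through \<open>ip\<close>) and the theorem (through \<open>on_interval\<close>).\<close>

fun p :: "real \<Rightarrow> nat \<Rightarrow> real \<Rightarrow> real" and q :: "real \<Rightarrow> nat \<Rightarrow> real \<Rightarrow> real" where
  "p \<omega> 0 = (\<lambda>x. cos (\<omega> * x))"
| "q \<omega> 0 = (\<lambda>x. sin (\<omega> * x))"
| "p \<omega> (Suc 0) = (\<lambda>x. x * p \<omega> 0 x + 1 / (2 * \<omega>) * q \<omega> 0 x)"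
| "q \<omega> (Suc 0) = (\<lambda>x. x * q \<omega> 0 x + 1 / (2 * \<omega>) * p \<omega> 0 x)"
| "p \<omega> (Suc (Suc k)) = (\<lambda>x. x * p \<omega> (Suc k) x
      - ip (\<lambda>t. t * p \<omega> (Suc k) t) (q \<omega> (Suc k)) / ip (q \<omega> (Suc k)) (q \<omega> (Suc k)) * q \<omega> (Suc k) x
      - ip (\<lambda>t. t * p \<omega> (Suc k) t) (p \<omega> k) / ip (p \<omega> k) (p \<omega> k) * p \<omega> k x)"
| "q \<omega> (Suc (Suc k)) = (\<lambda>x. x * q \<omega> (Suc k) x
      - ip (\<lambda>t. t * q \<omega> (Suc k) t) (p \<omega> (Suc k)) / ip (p \<omega> (Suc k)) (p \<omega> (Suc k)) * p \<omega> (Suc k) x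
      - ip (\<lambda>t. t * q \<omega> (Suc k) t) (q \<omega> k) / ip (q \<omega> k) (q \<omega> k) * q \<omega> k x)"

text \<open>The space of real functions on \<open>[-1,1]\<close> is represented by the functions on \<open>\<real>\<close>
  that vanish off \<open>[-1,1]\<close>; equality of two such functions is equality on \<open>[-1,1]\<close>. (HOL's
  \<open>restrict\<close>, with value \<open>undefined\<close> outside, would not be linear.)\<close>

definition on_interval :: "(real \<Rightarrow> real) \<Rightarrow> real \<Rightarrow> real" where
  "on_interval f = (\<lambda>x. if x \<in> {-1..1} then f x else 0)"

text \<open>A basis given as an indexed family: injectivity excludes repeated members, which
  independence of the image alone would not detect.\<close>

definition family_basis :: "('i \<Rightarrow> 'v::real_vector) \<Rightarrow> 'i set \<Rightarrow> 'v set \<Rightarrow> bool" where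
  "family_basis b I V \<longleftrightarrow> inj_on b I \<and> independent (b ` I) \<and> span (b ` I) = V"

end

theory Submission
  imports Defs "HOL-Complex_Analysis.Complex_Analysis"
begin

text \<open>Each step of the recursion multiplies by \<open>x\<close> and subtracts a combination of earlier
  functions, so, whatever the coefficients are, \<open>p\<^sub>k\<close> is \<open>x\<^sup>k cos (\<omega>x)\<close> and
  \<open>q\<^sub>k\<close> is \<open>x\<^sup>k sin (\<omega>x)\<close> up to terms of lower degree; hence the two families have the
  same span. If \<open>A(x) cos (\<omega>x) + B(x) sin (\<omega>x)\<close> vanishes on \<open>[-1,1]\<close>, then it vanishes on
  all of \<open>\<real>\<close> by analyticity, and evaluating it at the integers and at the integers shifted by
  \<open>1/(4m)\<close> gives \<open>A = 0\<close> and \<open>B = 0\<close>. So the span has dimension \<open>2(N+1)\<close>, and the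
  \<open>2(N+1)\<close> functions spanning it form a basis.\<close>

section \<open>Linear algebra of indexed families\<close>

text \<open>Coefficients are indexed by \<open>I\<close>, not by vectors, so a repeated member
  already yields a nontrivial relation: coefficient 1 at \<open>i\<close> and -1 at \<open>j\<close>
  when \<open>b i = b j\<close>.\<close>

lemma independent_familyI:
  fixes b :: "'i \<Rightarrow> 'v::real_vector"
  assumes "finite I"
    and zero: "\<And>c i. (\<Sum>i\<in>I. c i *\<^sub>R b i) = 0 \<Longrightarrow> i \<in> I \<Longrightarrow> c i = 0"
  shows "inj_on b I" and "independent (b ` I)"
proof -
  show inj: "inj_on b I"
  proof (rule inj_onI, rule ccontr)
    fix i j assume ij: "i \<in> I" "j \<in> I" "b i = b j" "i \<noteq> j"
    let ?c = "\<lambda>k. (if k = i then 1 else 0) - (if k = j then 1 else 0) :: real"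
    have "(\<Sum>k\<in>I. ?c k *\<^sub>R b k)
        = (\<Sum>k\<in>I. if k = i then b k else 0) - (\<Sum>k\<in>I. if k = j then b k else 0)"
      unfolding sum_subtractf[symmetric] by (intro sum.cong) (auto simp: ij(4))
    also have "\<dots> = 0"
      using ij \<open>finite I\<close> by simp
    finally show False
      using zero[of ?c i] ij by simp
  qed
  show "independent (b ` I)"
  proof (rule independent_if_scalars_zero)
    fix f x assume "(\<Sum>x\<in>b ` I. f x *\<^sub>R x) = 0" and "x \<in> b ` I"
    then show "f x = 0"
      using zero[of "f \<circ> b"] by (auto simp: sum.reindex[OF inj] o_def)
  qed (use \<open>finite I\<close> in simp)
qed

text \<open>A dimension count: the common span has dimension \<open>card I\<close>, so a family
  indexed by \<open>I\<close> that spans it can afford neither a repetition nor a linear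
  relation.\<close>

lemma family_basis_cardI:
  fixes b g :: "'i \<Rightarrow> 'v::real_vector"
  assumes "finite I" and "inj_on g I" and "independent (g ` I)"
    and span: "span (b ` I) = span (g ` I)"
  shows "family_basis b I (span (g ` I))"
proof -
  have "card I = dim (g ` I)"
    using assms by (simp add: dim_eq_card_independent card_image)
  also have "\<dots> = dim (b ` I)"
    by (metis dim_span span)
  finally have dim: "dim (b ` I) = card I" ..
  have "card I \<le> card (b ` I)"
    using dim_le_card[of "b ` I" "b ` I"] \<open>finite I\<close> dim by (simp add: span_superset)
  then have card: "card (b ` I) = card I"
    using card_image_le[OF \<open>finite I\<close>, of b] by simp
  \<comment> \<open>A basis extracted from the image has as many elements as the image itself, hence
    is all of it.\<close>
  obtain B where B: "B \<subseteq> b ` I" "independent B" "card B = dim (b ` I)"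
    by (rule basis_exists[of "b ` I"])
  then have "B = b ` I"
    using \<open>finite I\<close> dim card by (intro card_subset_eq) auto
  with B have "independent (b ` I)"
    by simp
  with eq_card_imp_inj_on[OF \<open>finite I\<close> card] span show ?thesis
    by (simp add: family_basis_def)
qed

section \<open>Linear independence of the functions x^k cos(\<omega>x), x^k sin(\<omega>x)\<close>

text \<open>The expression is the restriction to the reals of an entire function \<open>F\<close>,
  whose zeros accumulate at 0; the identity theorem applies.\<close>

lemma trig_polynomial_extend:
  fixes \<omega> :: real and a b :: "nat \<Rightarrow> real"
  assumes zero: "\<And>x. x \<in> {-1..1} \<Longrightarrow>
      (\<Sum>k\<le>N. a k * x ^ k) * cos (\<omega> * x) + (\<Sum>k\<le>N. b k * x ^ k) * sin (\<omega> * x) = 0"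
  shows "(\<Sum>k\<le>N. a k * x ^ k) * cos (\<omega> * x) + (\<Sum>k\<le>N. b k * x ^ k) * sin (\<omega> * x) = 0"
proof -
  define F where "F z = (\<Sum>k\<le>N. of_real (a k) * z ^ k) * cos (of_real \<omega> * z)
      + (\<Sum>k\<le>N. of_real (b k) * z ^ k) * sin (of_real \<omega> * z)" for z :: complex
  have F_real: "F (of_real x) =
    of_real ((\<Sum>k\<le>N. a k * x ^ k) * cos (\<omega> * x) + (\<Sum>k\<le>N. b k * x ^ k) * sin (\<omega> * x))" for x
  proof -
    have "cos (of_real \<omega> * of_real x :: complex) = of_real (cos (\<omega> * x))"
      "sin (of_real \<omega> * of_real x :: complex) = of_real (sin (\<omega> * x))"
      by (simp_all only: cos_of_real sin_of_real flip: of_real_mult)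
    then show ?thesis
      by (simp add: F_def)
  qed
  have "F (of_real x) = 0"
  proof (rule analytic_continuation[where f = F and S = UNIV and U = "of_real ` {-1..1}" and \<xi> = 0])
    show "F holomorphic_on UNIV"
      unfolding F_def by (intro holomorphic_intros)
    show "(0::complex) islimpt of_real ` {-1..1}"
    proof (rule islimptI)
      fix T :: "complex set" assume "0 \<in> T" "open T"
      then obtain e where e: "e > 0" "ball 0 e \<subseteq> T"
        using openE by blast
      \<comment> \<open>Halving \<open>e\<close> keeps the point inside the ball, and the cap 1
        keeps it in the interval.\<close>
      let ?y = "min (e / 2) 1"
      have "of_real ?y \<in> of_real ` {-1..1}"
        using e by (intro imageI) auto
      moreover have "(of_real ?y :: complex) \<in> T"
        using e by (intro subsetD[OF e(2)]) (auto simp: min_def norm_of_real)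
      moreover have "(of_real ?y :: complex) \<noteq> 0"
        using e unfolding of_real_eq_0_iff by auto
      ultimately show "\<exists>y\<in>of_real ` {-1..1}. y \<in> T \<and> y \<noteq> 0"
        by blast
    qed
    show "F z = 0" if "z \<in> of_real ` {-1..1}" for z
      using that by (auto simp only: F_real zero of_real_0)
  qed auto
  then show ?thesis
    unfolding F_real of_real_eq_0_iff .
qed

lemma polyfun_eq_0_infinite:
  fixes a :: "nat \<Rightarrow> real"
  assumes "infinite X" and "\<And>x. x \<in> X \<Longrightarrow> (\<Sum>k\<le>N. a k * x ^ k) = 0" and "k \<le> N"
  shows "a k = 0"
proof (rule ccontr)
  assume "a k \<noteq> 0"
  then have "finite {x. (\<Sum>k\<le>N. a k * x ^ k) = 0}"
    using \<open>k \<le> N\<close> by (simp add: polyfun_finite_roots) blast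
  moreover have "X \<subseteq> {x. (\<Sum>k\<le>N. a k * x ^ k) = 0}"
    using assms(2) by auto
  ultimately show False
    using assms(1) finite_subset by blast
qed

text \<open>Only finitely many of the sample points lie in [-1,1], so the identity is first extended
  to the whole line; infinitely many roots then kill each polynomial.\<close>

lemma trig_polynomial_eq_0:
  fixes m :: nat and \<omega> :: real and a b :: "nat \<Rightarrow> real"
  assumes "m \<ge> 1" and \<omega>: "\<omega> = 2 * pi * real m" and "k \<le> N"
    and zero: "\<And>x. x \<in> {-1..1} \<Longrightarrow>
      (\<Sum>k\<le>N. a k * x ^ k) * cos (\<omega> * x) + (\<Sum>k\<le>N. b k * x ^ k) * sin (\<omega> * x) = 0"
  shows "a k = 0" and "b k = 0"
proof -
  have ext: "(\<Sum>k\<le>N. a k * x ^ k) * cos (\<omega> * x) + (\<Sum>k\<le>N. b k * x ^ k) * sin (\<omega> * x) = 0" for x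
    using trig_polynomial_extend[OF zero] by blast
  have trig: "cos (\<omega> * real n) = 1" "sin (\<omega> * real n) = 0" for n
  proof -
    have "\<omega> * real n = 2 * real (m * n) * pi"
      by (simp add: \<omega>)
    then show "cos (\<omega> * real n) = 1" "sin (\<omega> * real n) = 0"
      by (simp_all only: cos_2npi sin_2npi)
  qed
  \<comment> \<open>The period is 1/m, so 1/(4m) is a quarter period, which isolates the sine
    part.\<close>
  have shift: "\<omega> * (real n + 1 / (4 * real m)) = \<omega> * real n + pi / 2" for n
    using \<open>m \<ge> 1\<close> by (simp add: \<omega> field_simps)
  have trig_shift: "cos (\<omega> * (real n + 1 / (4 * real m))) = 0"
    "sin (\<omega> * (real n + 1 / (4 * real m))) = 1" for n
    unfolding shift by (simp_all add: cos_add sin_add trig)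
  show "a k = 0"
  proof (rule polyfun_eq_0_infinite[OF _ _ \<open>k \<le> N\<close>])
    show "infinite (range real)"
      by (rule range_inj_infinite) (simp add: inj_on_def)
    show "(\<Sum>k\<le>N. a k * x ^ k) = 0" if "x \<in> range real" for x
      using that ext[of x] by (auto simp: trig)
  qed
  show "b k = 0"
  proof (rule polyfun_eq_0_infinite[OF _ _ \<open>k \<le> N\<close>])
    show "infinite (range (\<lambda>n. real n + 1 / (4 * real m)))"
      by (rule range_inj_infinite) (simp add: inj_on_def)
    show "(\<Sum>k\<le>N. b k * x ^ k) = 0" if "x \<in> range (\<lambda>n. real n + 1 / (4 * real m))" for x
      using that ext[of x] by (auto simp: trig_shift)
  qed
qed

text \<open>The index type matches that of the \<open>p\<close>, \<open>q\<close> family: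
  \<open>Inl\<close> for cosines, \<open>Inr\<close> for sines.\<close>

definition trig_monomial :: "real \<Rightarrow> nat + nat \<Rightarrow> real \<Rightarrow> real" where
  "trig_monomial \<omega> = case_sum (\<lambda>k. on_interval (\<lambda>x. x ^ k * cos (\<omega> * x)))
                              (\<lambda>k. on_interval (\<lambda>x. x ^ k * sin (\<omega> * x)))"

lemma sum_fun_apply: "(\<Sum>i\<in>I. f i) x = (\<Sum>i\<in>I. f i x)"
  for f :: "'i \<Rightarrow> 'a \<Rightarrow> 'b::comm_monoid_add"
  by (induction I rule: infinite_finite_induct) auto

lemma trig_monomial_independent:
  fixes m N :: nat
  assumes "m \<ge> 1" and "\<omega> = 2 * pi * real m"
  shows "inj_on (trig_monomial \<omega>) ({..N} <+> {..N})"
    and "independent (trig_monomial \<omega> ` ({..N} <+> {..N}))"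
proof -
  have "c i = 0"
    if sum: "(\<Sum>i\<in>{..N} <+> {..N}. c i *\<^sub>R trig_monomial \<omega> i) = 0" and i: "i \<in> {..N} <+> {..N}"
    for c i
  proof -
    have zero: "(\<Sum>k\<le>N. c (Inl k) * x ^ k) * cos (\<omega> * x)
        + (\<Sum>k\<le>N. c (Inr k) * x ^ k) * sin (\<omega> * x) = 0" if "x \<in> {-1..1}" for x
      using fun_cong[OF sum, of x] that
      by (simp add: sum.Plus sum_fun_apply scaleR_fun_def trig_monomial_def on_interval_def
          sum_distrib_right mult.assoc)
    show ?thesis
      using i trig_polynomial_eq_0[OF assms _ zero] by (elim PlusE) auto
  qed
  then show "inj_on (trig_monomial \<omega>) ({..N} <+> {..N})"
    and "independent (trig_monomial \<omega> ` ({..N} <+> {..N}))"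
    using independent_familyI[of "{..N} <+> {..N}" "trig_monomial \<omega>"] by auto
qed

section \<open>Filtration by degree and leading terms of the recursion\<close>

text \<open>The bound is strict: \<open>trig_space \<omega> k\<close> holds exactly the terms of
  lower degree than k, and \<open>trig_space \<omega> 0\<close> is the zero space.\<close>

definition trig_space :: "real \<Rightarrow> nat \<Rightarrow> (real \<Rightarrow> real) set" where
  "trig_space \<omega> n = span (trig_monomial \<omega> ` ({..<n} <+> {..<n}))"

lemma trig_space_mono: "n \<le> n' \<Longrightarrow> trig_space \<omega> n \<subseteq> trig_space \<omega> n'"
  unfolding trig_space_def by (intro span_mono image_mono) auto

lemma trig_monomial_in_trig_space:
  "k < n \<Longrightarrow> trig_monomial \<omega> (Inl k) \<in> trig_space \<omega> n"
  "k < n \<Longrightarrow> trig_monomial \<omega> (Inr k) \<in> trig_space \<omega> n"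
  unfolding trig_space_def by (auto intro: span_base)

lemma mult_id_trig_monomial:
  "(\<lambda>x. x * trig_monomial \<omega> (Inl k) x) = trig_monomial \<omega> (Inl (Suc k))"
  "(\<lambda>x. x * trig_monomial \<omega> (Inr k) x) = trig_monomial \<omega> (Inr (Suc k))"
  by (auto simp: trig_monomial_def on_interval_def fun_eq_iff)

lemma mult_id_trig_space:
  assumes "f \<in> trig_space \<omega> n"
  shows "(\<lambda>x. x * f x) \<in> trig_space \<omega> (Suc n)"
  using assms unfolding trig_space_def
proof (induction rule: span_induct_alt)
  case base
  have "(\<lambda>x. x * (0 :: real \<Rightarrow> real) x) = 0"
    by (simp add: fun_eq_iff)
  then show ?case
    by (simp add: span_zero)
next
  case (step c g f)
  have "(\<lambda>x. x * (c *\<^sub>R g + f) x) = c *\<^sub>R (\<lambda>x. x * g x) + (\<lambda>x. x * f x)"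
    by (simp add: fun_eq_iff scaleR_fun_def algebra_simps)
  moreover have "(\<lambda>x. x * g x) \<in> trig_space \<omega> (Suc n)"
    using step.hyps by (auto simp: mult_id_trig_monomial trig_monomial_in_trig_space)
  ultimately show ?case
    using step.IH unfolding trig_space_def by (simp add: span_add span_scale)
qed

text \<open>Multiplication by x raises the leading monomial and the remainder by one degree each;
  the subtracted terms have lower degree. Strong induction, since the recursion reaches back two
  indices.\<close>

lemma p_q_leading_term:
  "on_interval (p \<omega> k) - trig_monomial \<omega> (Inl k) \<in> trig_space \<omega> k \<and>
   on_interval (q \<omega> k) - trig_monomial \<omega> (Inr k) \<in> trig_space \<omega> k"
proof (induction k rule: less_induct)
  case (less k)
  note closed = span_add[of _ "trig_monomial \<omega> ` ({..<k} <+> {..<k})", folded trig_space_def]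
    span_scale[of _ "trig_monomial \<omega> ` ({..<k} <+> {..<k})", folded trig_space_def]
  \<comment> \<open>Earlier functions have degree j, as leading monomial and remainder both lie in
    \<open>trig_space \<omega> n\<close>.\<close>
  have mem: "on_interval (p \<omega> j) \<in> trig_space \<omega> n" "on_interval (q \<omega> j) \<in> trig_space \<omega> n"
    if "j < k" "j < n" for j n
  proof -
    have "on_interval (p \<omega> j) - trig_monomial \<omega> (Inl j) \<in> trig_space \<omega> n"
      "on_interval (q \<omega> j) - trig_monomial \<omega> (Inr j) \<in> trig_space \<omega> n"
      using less.IH[OF \<open>j < k\<close>] trig_space_mono[OF less_imp_le[OF \<open>j < n\<close>], of \<omega>] by blast+
    then show "on_interval (p \<omega> j) \<in> trig_space \<omega> n" "on_interval (q \<omega> j) \<in> trig_space \<omega> n"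
      using trig_monomial_in_trig_space[OF \<open>j < n\<close>, of \<omega>]
      unfolding trig_space_def by (metis diff_add_cancel span_add)+
  qed
  have mult: "(\<lambda>x. x * on_interval (p \<omega> j) x) - trig_monomial \<omega> (Inl (Suc j)) \<in> trig_space \<omega> (Suc j)"
    "(\<lambda>x. x * on_interval (q \<omega> j) x) - trig_monomial \<omega> (Inr (Suc j)) \<in> trig_space \<omega> (Suc j)"
    if "j < k" for j
    using less.IH[OF that, THEN conjunct1, THEN mult_id_trig_space]
      less.IH[OF that, THEN conjunct2, THEN mult_id_trig_space]
    by (simp_all add: mult_id_trig_monomial[symmetric] fun_diff_def right_diff_distrib)
  consider "k = 0" | "k = Suc 0" | j where "k = Suc (Suc j)"
    by (metis not0_implies_Suc)
  then show ?case
  proof cases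
    case 1
    have "on_interval (p \<omega> k) - trig_monomial \<omega> (Inl k) = 0"
      "on_interval (q \<omega> k) - trig_monomial \<omega> (Inr k) = 0"
      by (simp_all add: 1 trig_monomial_def)
    then show ?thesis
      by (simp only: trig_space_def span_zero)
  next
    case 2
    have eq: "on_interval (p \<omega> k) - trig_monomial \<omega> (Inl k)
        = ((\<lambda>x. x * on_interval (p \<omega> 0) x) - trig_monomial \<omega> (Inl k))
          + (1 / (2 * \<omega>)) *\<^sub>R on_interval (q \<omega> 0)"
      "on_interval (q \<omega> k) - trig_monomial \<omega> (Inr k)
        = ((\<lambda>x. x * on_interval (q \<omega> 0) x) - trig_monomial \<omega> (Inr k))
          + (1 / (2 * \<omega>)) *\<^sub>R on_interval (p \<omega> 0)"
      by (auto simp: 2 fun_eq_iff on_interval_def scaleR_fun_def)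
    have "0 < k"
      by (simp add: 2)
    then show ?thesis
      unfolding eq by (intro conjI closed mult[of 0, folded 2] mem)
  next
    case (3 j)
    \<comment> \<open>The quotients of inner products, with their minus signs, are hidden behind
      plain scalars: membership in the span does not depend on their values.\<close>
    obtain a b c d where eq: "on_interval (p \<omega> k) - trig_monomial \<omega> (Inl k)
        = ((\<lambda>x. x * on_interval (p \<omega> (Suc j)) x) - trig_monomial \<omega> (Inl k))
          + a *\<^sub>R on_interval (q \<omega> (Suc j)) + b *\<^sub>R on_interval (p \<omega> j)"
      "on_interval (q \<omega> k) - trig_monomial \<omega> (Inr k)
        = ((\<lambda>x. x * on_interval (q \<omega> (Suc j)) x) - trig_monomial \<omega> (Inr k))
          + c *\<^sub>R on_interval (p \<omega> (Suc j)) + d *\<^sub>R on_interval (q \<omega> j)"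
    proof
      show "on_interval (p \<omega> k) - trig_monomial \<omega> (Inl k)
        = ((\<lambda>x. x * on_interval (p \<omega> (Suc j)) x) - trig_monomial \<omega> (Inl k))
          + (- ip (\<lambda>t. t * p \<omega> (Suc j) t) (q \<omega> (Suc j)) / ip (q \<omega> (Suc j)) (q \<omega> (Suc j)))
              *\<^sub>R on_interval (q \<omega> (Suc j))
          + (- ip (\<lambda>t. t * p \<omega> (Suc j) t) (p \<omega> j) / ip (p \<omega> j) (p \<omega> j)) *\<^sub>R on_interval (p \<omega> j)"
        unfolding 3 p.simps(3) by (auto simp: fun_eq_iff on_interval_def scaleR_fun_def)
      show "on_interval (q \<omega> k) - trig_monomial \<omega> (Inr k)
        = ((\<lambda>x. x * on_interval (q \<omega> (Suc j)) x) - trig_monomial \<omega> (Inr k))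
          + (- ip (\<lambda>t. t * q \<omega> (Suc j) t) (p \<omega> (Suc j)) / ip (p \<omega> (Suc j)) (p \<omega> (Suc j)))
              *\<^sub>R on_interval (p \<omega> (Suc j))
          + (- ip (\<lambda>t. t * q \<omega> (Suc j) t) (q \<omega> j) / ip (q \<omega> j) (q \<omega> j)) *\<^sub>R on_interval (q \<omega> j)"
        unfolding 3 q.simps(3) by (auto simp: fun_eq_iff on_interval_def scaleR_fun_def)
    qed
    have "Suc j < k" "j < k"
      by (simp_all add: 3)
    then show ?thesis
      unfolding eq by (intro conjI closed mult[of "Suc j", folded 3] mem)
  qed
qed

text \<open>The two families differ by a unitriangular change: modulo
  \<open>trig_space \<omega> n\<close>, the members of degree n coincide.\<close>

lemma span_p_q:
  "span (case_sum (\<lambda>k. on_interval (p \<omega> k)) (\<lambda>k. on_interval (q \<omega> k)) ` ({..<n} <+> {..<n}))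
    = trig_space \<omega> n"
  (is "span (?b ` _) = _")
proof (induction n)
  case 0
  show ?case
    by (simp add: trig_space_def Plus_def)
next
  case (Suc n)
  have sub: "trig_space \<omega> n \<subseteq> span (?b ` ({..<Suc n} <+> {..<Suc n}))"
    unfolding Suc.IH[symmetric] by (intro span_mono image_mono) auto
  have b_mem: "?b i \<in> span (?b ` ({..<Suc n} <+> {..<Suc n}))"
    if "i \<in> {..<Suc n} <+> {..<Suc n}" for i
    using that by (intro span_base) blast
  have diff: "?b i - trig_monomial \<omega> i \<in> trig_space \<omega> n" if "i \<in> {..<Suc n} <+> {..<Suc n}" for i
    using that
  proof (elim PlusE)
    fix k assume "k \<in> {..<Suc n}"
    then have "trig_space \<omega> k \<subseteq> trig_space \<omega> n"
      by (intro trig_space_mono) simp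
    then show "i = Inl k \<Longrightarrow> ?b i - trig_monomial \<omega> i \<in> trig_space \<omega> n"
      "i = Inr k \<Longrightarrow> ?b i - trig_monomial \<omega> i \<in> trig_space \<omega> n"
      using p_q_leading_term[of \<omega> k] by auto
  qed
  show ?case
  proof
    show "span (?b ` ({..<Suc n} <+> {..<Suc n})) \<subseteq> trig_space \<omega> (Suc n)"
      unfolding trig_space_def
    proof (rule span_minimal)
      show "?b ` ({..<Suc n} <+> {..<Suc n}) \<subseteq> span (trig_monomial \<omega> ` ({..<Suc n} <+> {..<Suc n}))"
      proof (rule image_subsetI)
        fix i assume i: "i \<in> {..<Suc n} <+> {..<Suc n}"
        have "?b i - trig_monomial \<omega> i \<in> span (trig_monomial \<omega> ` ({..<Suc n} <+> {..<Suc n}))"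
          using diff[OF i] trig_space_mono[of n "Suc n" \<omega>] by (auto simp: trig_space_def)
        then show "?b i \<in> span (trig_monomial \<omega> ` ({..<Suc n} <+> {..<Suc n}))"
          using span_base[OF imageI[OF i, of "trig_monomial \<omega>"]] by (metis diff_add_cancel span_add)
      qed
    qed simp
    show "trig_space \<omega> (Suc n) \<subseteq> span (?b ` ({..<Suc n} <+> {..<Suc n}))"
      unfolding trig_space_def
    proof (rule span_minimal)
      show "trig_monomial \<omega> ` ({..<Suc n} <+> {..<Suc n}) \<subseteq> span (?b ` ({..<Suc n} <+> {..<Suc n}))"
      proof (rule image_subsetI)
        fix i assume i: "i \<in> {..<Suc n} <+> {..<Suc n}"
        \<comment> \<open>The remainder has degree below n, so by the induction hypothesis it is
          already a combination of the \<open>p\<close> and \<open>q\<close>.\<close>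
        have "?b i - (?b i - trig_monomial \<omega> i) \<in> span (?b ` ({..<Suc n} <+> {..<Suc n}))"
          using b_mem[OF i] subsetD[OF sub diff[OF i]] by (rule span_diff)
        then show "trig_monomial \<omega> i \<in> span (?b ` ({..<Suc n} <+> {..<Suc n}))"
          by simp
      qed
    qed simp
  qed
qed

theorem theorem2p1:
  fixes m N :: nat and \<omega> :: real
  assumes "m \<ge> 1" and "\<omega> = 2 * pi * real m"
  shows "family_basis
    (case_sum (\<lambda>k. on_interval (p \<omega> k)) (\<lambda>k. on_interval (q \<omega> k)))
    ({0..N} <+> {0..N})
    (span ((\<lambda>k. on_interval (\<lambda>x. x ^ k * sin (\<omega> * x))) ` {0..N}
         \<union> (\<lambda>k. on_interval (\<lambda>x. x ^ k * cos (\<omega> * x))) ` {0..N}))"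
proof -
  \<comment> \<open>Rewrites the generators as one family over the index set of the \<open>p\<close>
    and \<open>q\<close>, so that the dimension count applies.\<close>
  have "(\<lambda>k. on_interval (\<lambda>x. x ^ k * sin (\<omega> * x))) ` {0..N}
      \<union> (\<lambda>k. on_interval (\<lambda>x. x ^ k * cos (\<omega> * x))) ` {0..N}
      = trig_monomial \<omega> ` ({..N} <+> {..N})"
    by (auto simp: Plus_def image_Un image_image trig_monomial_def atLeast0AtMost)
  moreover have "family_basis (case_sum (\<lambda>k. on_interval (p \<omega> k)) (\<lambda>k. on_interval (q \<omega> k)))
      ({..N} <+> {..N}) (span (trig_monomial \<omega> ` ({..N} <+> {..N})))"
    using trig_monomial_independent[OF assms] span_p_q[of \<omega> "Suc N"]
    by (intro family_basis_cardI) (simp_all add: trig_space_def lessThan_Suc_atMost)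
  ultimately show ?thesis
    by (simp add: atLeast0AtMost)
qed

end
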